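(* Let $N\ge1$ be an integer and $\phi\in(-\pi/2,\pi/2)$, and let $\Gamma=\{xe^{i\phi\,\mathrm{sgn}(x)}:x\in\mathbb{R}\}$, which consists of the two rays $\{re^{i\phi}:r\ge0\}$ and $\{re^{i(\pi-\phi)}:r\ge 0\}$ (symmetric with respect to the imaginary axis). (i) If $\Gamma\setminus\{0\}$ is contained in the union of the Stokes wedges $S_k$, then for every $\lambda\in\mathbb{C}$ each of the two half-line equations $$-e^{\mp 2i\phi}w''(x)-(ix)^{N+2}e^{\pm(N+2)i\phi}w(x)=\lambda w(x),\quad x\in\mathbb{R}_\pm,$$ is in the limit-point case: up to a constant multiple it has exactly one nonzero solution in $L^2(\mathbb{R}_+)$, resp. $L^2(\mathbb{R}_-)$. (ii) If $\Gamma$ lies on Stokes lines $L_k$, then for every $\lambda\in\mathbb{C}$ each of these equations is in the limit-circle case: all its solutions lie in $L^2(\mathbb{R}_+)$, resp. $L^2(\mathbb{R}_-)$.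
   Context: With $\theta_k=-\frac{N+2}{2N+8}\pi+\frac{2k}{N+4}\pi$, $k=0,\dots,N+3$, the Stokes lines are the rays $L_k=\{z\in\mathbb{C}:\arg z=\theta_k\}$ and the Stokes wedges are the open sectors $S_k=\{z\in\mathbb{C}:\theta_{k-1}<\arg z<\theta_k\}$ (arguments taken modulo $2\pi$). Here $\mathbb{R}_+=[0,\infty)$, $\mathbb{R}_-=(-\infty,0]$; solutions have $w,w'$ locally absolutely continuous. *)

theory Defs
  imports "HOL-Analysis.Analysis"
begin

text \<open>Stokes angles theta_k, for integer k (theta_(-1) gives the lower boundary of S_0).\<close>
definition stokes_theta :: "nat \<Rightarrow> int \<Rightarrow> real" where
  "stokes_theta N k = - (real N + 2) / (2 * real N + 8) * pi + 2 * real_of_int k / (real N + 4) * pi"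

definition stokes_line :: "nat \<Rightarrow> int \<Rightarrow> complex set" where
  "stokes_line N k = {complex_of_real r * cis (stokes_theta N k) | r. r \<ge> 0}"

definition stokes_wedge :: "nat \<Rightarrow> int \<Rightarrow> complex set" where
  "stokes_wedge N k = {z. z \<noteq> 0 \<and> (\<exists>t. z = complex_of_real (cmod z) * cis t
        \<and> stokes_theta N (k - 1) < t \<and> t < stokes_theta N k)}"

definition Gamma_contour :: "real \<Rightarrow> complex set" where
  "Gamma_contour \<phi> = {complex_of_real x * cis (\<phi> * sgn x) | x. True}"

text \<open>w solves  -c w'' - p w = lam w  on the interval I, with w and w' locally absolutely
  continuous on I (w1 plays the role of w', w2 of w''), the equation holding a.e. on I.\<close>
definition is_solution ::
  "complex \<Rightarrow> (real \<Rightarrow> complex) \<Rightarrow> complex \<Rightarrow> real set \<Rightarrow> (real \<Rightarrow> complex) \<Rightarrow> bool" where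
  "is_solution c p lam I w \<longleftrightarrow>
     (\<exists>w1 w2. (\<forall>a\<in>I. \<forall>b\<in>I. a \<le> b \<longrightarrow>
                  w1 absolutely_integrable_on {a..b} \<and> (w1 has_integral (w b - w a)) {a..b} \<and>
                  w2 absolutely_integrable_on {a..b} \<and> (w2 has_integral (w1 b - w1 a)) {a..b})
             \<and> negligible {x \<in> I. - c * w2 x - p x * w x \<noteq> lam * w x})"

definition square_integrable :: "real set \<Rightarrow> (real \<Rightarrow> complex) \<Rightarrow> bool" where
  "square_integrable I w \<longleftrightarrow> (\<lambda>x. (cmod (w x))\<^sup>2) integrable_on I"

definition limit_point ::
  "complex \<Rightarrow> (real \<Rightarrow> complex) \<Rightarrow> complex \<Rightarrow> real set \<Rightarrow> bool" where
  "limit_point c p lam I \<longleftrightarrow>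
     (\<exists>w0. is_solution c p lam I w0 \<and> square_integrable I w0 \<and> (\<exists>x\<in>I. w0 x \<noteq> 0) \<and>
        (\<forall>w. is_solution c p lam I w \<and> square_integrable I w \<longrightarrow>
              (\<exists>a. \<forall>x\<in>I. w x = a * w0 x)))"

definition limit_circle ::
  "complex \<Rightarrow> (real \<Rightarrow> complex) \<Rightarrow> complex \<Rightarrow> real set \<Rightarrow> bool" where
  "limit_circle c p lam I \<longleftrightarrow> (\<forall>w. is_solution c p lam I w \<longrightarrow> square_integrable I w)"

text \<open>Coefficients of the half-line equations; s = 1 for R_+, s = -1 for R_-.\<close>
definition lead_coeff_hl :: "real \<Rightarrow> real \<Rightarrow> complex" where
  "lead_coeff_hl s \<phi> = exp (- s * 2 * \<i> * complex_of_real \<phi>)"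

definition potential_hl :: "nat \<Rightarrow> real \<Rightarrow> real \<Rightarrow> real \<Rightarrow> complex" where
  "potential_hl N s \<phi> x = (\<i> * complex_of_real x) ^ (N + 2) * exp (s * (of_nat N + 2) * \<i> * complex_of_real \<phi>)"

end

theory Submission
  imports Defs
begin

text \<open>
  After reflecting the negative half-line, both equations read \<open>w'' = (A x\<^sup>m + B) w\<close> on \<open>[0,\<infinity>)\<close> with
  \<open>m = N + 2\<close> and \<open>A\<close> equal to \<open>exp (i (N + 4) (\<phi> + \<pi>/2))\<close> or its conjugate. The contour lies on Stokes
  lines iff \<open>A = - 1\<close>, and in the wedges iff \<open>A\<close> is off the negative real axis.

  If \<open>A\<close> is not in \<open>(-\<infinity>,0]\<close>, pick \<open>e\<close> with \<open>Re e > 0\<close> and \<open>Re (e A) > 0\<close>. For large \<open>x\<close>, the function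
  \<open>G = Re (e w' cnj w)\<close> satisfies \<open>G' \<ge> d (|w|\<^sup>2 + |w'|\<^sup>2)\<close>, and a solution is square integrable
  iff \<open>G\<close> stays nonpositive. This forces uniqueness, since a square integrable solution that vanishes
  at one large point vanishes, and gives existence by a compactness argument.

  If \<open>A = - 1\<close>, a modified energy shows \<open>|w|\<^sup>2 = O(x powr (- m/2))\<close>, which is integrable as \<open>m \<ge> 3\<close>.
\<close>

section \<open>Classical solutions and their equivalence with almost-everywhere solutions\<close>

text \<open>The derivatives are one-sided at 0, so initial data at the end point make sense;
  \<open>w'\<close> is an explicit argument because the energies below use it pointwise.\<close>

definition ode_sol :: "(real \<Rightarrow> complex) \<Rightarrow> (real \<Rightarrow> complex) \<Rightarrow> (real \<Rightarrow> complex) \<Rightarrow> bool" where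
  "ode_sol q w w' \<longleftrightarrow>
     (\<forall>x\<ge>0. (w has_vector_derivative w' x) (at x within {0..}) \<and>
            (w' has_vector_derivative q x * w x) (at x within {0..}))"

lemma ode_sol_D:
  assumes "ode_sol q w w'" "x > 0"
  shows "(w has_vector_derivative w' x) (at x)" "(w' has_vector_derivative q x * w x) (at x)"
proof -
  have "at x within {0..} = at x"
    using assms(2) by (intro at_within_interior) simp
  then show "(w has_vector_derivative w' x) (at x)" "(w' has_vector_derivative q x * w x) (at x)"
    using assms unfolding ode_sol_def by (metis less_imp_le)+
qed

lemma ode_sol_continuous:
  assumes "ode_sol q w w'"
  shows "continuous_on {0..} w" "continuous_on {0..} w'"
  using assms unfolding ode_sol_def
  by (auto simp: continuous_on_eq_continuous_within intro: has_vector_derivative_continuous)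

lemma ode_sol_lincomb:
  assumes "ode_sol q u u'" "ode_sol q v v'"
  shows "ode_sol q (\<lambda>x. a * u x + b * v x) (\<lambda>x. a * u' x + b * v' x)"
  using assms unfolding ode_sol_def
  by (auto simp: algebra_simps intro!: derivative_eq_intros has_vector_derivative_mult_right)

lemma at_within_atLeast_eq:
  fixes x a :: real
  assumes "a \<le> x"
  shows "at x within {a..x+1} = at x within {a..}"
  using assms by (intro at_within_nhd[of x "{..<x+1}"]) auto

lemma integral_has_vector_derivative_atLeast:
  fixes f :: "real \<Rightarrow> 'a::banach"
  assumes "continuous_on {a..} f" "a \<le> x"
  shows "((\<lambda>u. integral {a..u} f) has_vector_derivative f x) (at x within {a..})"
proof -
  have "continuous_on {a..x+1} f"
    using assms(1) by (rule continuous_on_subset) auto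
  then show ?thesis
    using integral_has_vector_derivative[of a "x+1" f x] assms(2)
    by (simp add: at_within_atLeast_eq)
qed

lemma has_vector_derivative_atLeast_if_integral:
  fixes f F :: "real \<Rightarrow> 'a::banach"
  assumes "continuous_on {a..} f" "a \<le> x"
    and "\<And>b. a \<le> b \<Longrightarrow> (f has_integral (F b - F a)) {a..b}"
  shows "(F has_vector_derivative f x) (at x within {a..})"
proof -
  have *: "((\<lambda>u. F a + integral {a..u} f) has_vector_derivative f x) (at x within {a..})"
    by (auto intro!: derivative_eq_intros integral_has_vector_derivative_atLeast assms)
  show ?thesis
    by (rule has_vector_derivative_transform[OF _ _ *])
       (use assms(2) in \<open>auto dest!: assms(3) simp: integral_unique\<close>)
qed

lemma continuous_on_atLeast_if_integral:
  fixes f F :: "real \<Rightarrow> 'a::banach"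
  assumes "\<And>b. a \<le> b \<Longrightarrow> (f has_integral (F b - F a)) {a..b}"
  shows "continuous_on {a..} F"
  unfolding continuous_on_eq_continuous_within
proof
  fix x assume "x \<in> {a..}"
  then have x: "a \<le> x" by simp
  have "continuous_on {a..x+1} (\<lambda>u. F a + integral {a..u} f)"
    using x by (intro continuous_intros indefinite_integral_continuous_1
        has_integral_integrable[OF assms]) auto
  then have "continuous_on {a..x+1} F"
    by (rule continuous_on_eq) (simp add: integral_unique[OF assms])
  then have "continuous (at x within {a..x+1}) F"
    using x by (simp add: continuous_on_eq_continuous_within)
  then show "continuous (at x within {a..}) F"
    using x by (simp add: at_within_atLeast_eq)
qed

text \<open>Indefinite integrals are continuous, so \<open>w\<close> and \<open>w1\<close> are.
  Hence \<open>w2\<close> agrees almost everywhere with the continuous function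
  \<open>q x * w x\<close>, and \<open>w1\<close> is continuously differentiable. The converse takes
  \<open>q x * w x\<close> as second derivative.\<close>

lemma is_solution_iff_ode_sol:
  assumes "c \<noteq> 0" "continuous_on {0..} q" and q: "\<And>x. x \<ge> 0 \<Longrightarrow> p x + lam = - c * q x"
  shows "is_solution c p lam {0..} w \<longleftrightarrow> (\<exists>w'. ode_sol q w w')"
proof -
  have eq: "- c * z - p x * w x \<noteq> lam * w x \<longleftrightarrow> z \<noteq> q x * w x" if "x \<ge> 0" for x z
  proof -
    have "- c * z - p x * w x = lam * w x \<longleftrightarrow> - c * z = (p x + lam) * w x"
      by (auto simp: algebra_simps)
    also have "\<dots> \<longleftrightarrow> z = q x * w x"
      using assms(1) by (simp add: q[OF that])
    finally show ?thesis by simp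
  qed
  show ?thesis
  proof
    assume "is_solution c p lam {0..} w"
    then obtain w1 w2 where
      H: "\<forall>a\<in>{0..}. \<forall>b\<in>{0..}. a \<le> b \<longrightarrow>
            w1 absolutely_integrable_on {a..b} \<and> (w1 has_integral (w b - w a)) {a..b} \<and>
            w2 absolutely_integrable_on {a..b} \<and> (w2 has_integral (w1 b - w1 a)) {a..b}"
      and n: "negligible {x \<in> {0..}. - c * w2 x - p x * w x \<noteq> lam * w x}"
      unfolding is_solution_def by (elim exE conjE)
    have h: "(w1 has_integral (w b - w 0)) {0..b}" "(w2 has_integral (w1 b - w1 0)) {0..b}"
      if "0 \<le> b" for b
      using H[rule_format, of 0 b] that by simp_all
    have h3: "((\<lambda>x. q x * w x) has_integral (w1 b - w1 0)) {0..b}" if "0 \<le> b" for b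
      by (rule has_integral_spike[OF n _ h(2)[OF that]]) (use eq in auto)
    have cw: "continuous_on {0..} w"
      by (rule continuous_on_atLeast_if_integral[OF h(1)])
    have cw1: "continuous_on {0..} w1"
      by (rule continuous_on_atLeast_if_integral[OF h(2)])
    have "ode_sol q w w1"
      unfolding ode_sol_def
      by (intro allI impI conjI has_vector_derivative_atLeast_if_integral
            continuous_on_mult assms cw cw1 h(1) h3) auto
    then show "\<exists>w'. ode_sol q w w'" by blast
  next
    assume "\<exists>w'. ode_sol q w w'"
    then obtain w' where w': "ode_sol q w w'" ..
    note cont = ode_sol_continuous[OF w']
    have "w' absolutely_integrable_on {a..b} \<and> (w' has_integral (w b - w a)) {a..b} \<and>
          (\<lambda>x. q x * w x) absolutely_integrable_on {a..b} \<and>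
          ((\<lambda>x. q x * w x) has_integral (w' b - w' a)) {a..b}" if "0 \<le> a" "a \<le> b" for a b
    proof (intro conjI)
      have sub: "{a..b} \<subseteq> {0..}" using that by auto
      show "w' absolutely_integrable_on {a..b}" "(\<lambda>x. q x * w x) absolutely_integrable_on {a..b}"
        by (auto intro!: absolutely_integrable_continuous_real continuous_on_subset[OF _ sub]
              continuous_on_mult cont assms)
      show "(w' has_integral (w b - w a)) {a..b}" "((\<lambda>x. q x * w x) has_integral (w' b - w' a)) {a..b}"
        using w' sub that unfolding ode_sol_def
        by (auto intro!: fundamental_theorem_of_calculus has_vector_derivative_within_subset[OF _ sub])
    qed
    moreover have "{x \<in> {0..}. - c * (q x * w x) - p x * w x \<noteq> lam * w x} = {}"
      using eq by blast
    then have "negligible {x \<in> {0..}. - c * (q x * w x) - p x * w x \<noteq> lam * w x}"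
      by (simp only: negligible_empty)
    ultimately show "is_solution c p lam {0..} w"
      unfolding is_solution_def
      by - (rule exI[of _ w'], rule exI[of _ "\<lambda>x. q x * w x"], rule conjI, simp, assumption)
  qed
qed

subsection \<open>Power series solutions\<close>

text \<open>Taylor coefficients at 0 of the solution of \<open>w'' = (A z^m + B) w\<close> with
  initial data \<open>\<alpha>\<close>, \<open>\<beta>\<close>; the recursion compares coefficients
  of \<open>z^n\<close>.\<close>

fun ode_coeff :: "complex \<Rightarrow> complex \<Rightarrow> nat \<Rightarrow> complex \<Rightarrow> complex \<Rightarrow> nat \<Rightarrow> complex" where
  "ode_coeff A B m \<alpha> \<beta> 0 = \<alpha>"
| "ode_coeff A B m \<alpha> \<beta> (Suc 0) = \<beta>"
| "ode_coeff A B m \<alpha> \<beta> (Suc (Suc n)) =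
     ((if m \<le> n then A * ode_coeff A B m \<alpha> \<beta> (n - m) else 0) + B * ode_coeff A B m \<alpha> \<beta> n)
       / (of_nat (Suc n) * of_nat (Suc (Suc n)))"

text \<open>The recursion multiplies the bound on the weighted coefficients by at most
  \<open>K / ((k + 1) * (k + 2))\<close>, which is at most 1 once \<open>k >= n0\<close>. So the
  maximum over the indices up to \<open>n0 + 1\<close> is never exceeded afterwards.\<close>

lemma ode_coeff_bounded:
  fixes \<rho> :: real
  assumes "\<rho> > 0"
  shows "\<exists>M. \<forall>n. norm (ode_coeff A B m \<alpha> \<beta> n) * \<rho> ^ n \<le> M"
proof -
  let ?a = "ode_coeff A B m \<alpha> \<beta>"
  define b where "b n = norm (?a n) * \<rho> ^ n" for n
  define K where "K = \<rho>\<^sup>2 * (norm A * \<rho> ^ m + norm B)"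
  obtain n0 where n0: "K \<le> real n0" using real_arch_simple by blast
  define M where "M = Max (b ` {..Suc n0})"
  have b0: "b n \<ge> 0" for n using assms by (simp add: b_def)
  have M1: "b n \<le> M" if "n \<le> Suc n0" for n
    unfolding M_def using that by (intro Max_ge) auto
  have M0: "M \<ge> 0" using b0[of 0] M1[of 0] by simp
  have "b n \<le> M" for n
  proof (induction n rule: less_induct)
    case (less n)
    show ?case
    proof (cases "n \<le> Suc n0")
      case False
      then obtain k where n: "n = Suc (Suc k)" and k: "n0 \<le> k"
        by (metis Suc_le_D not_less_eq_eq)
      let ?u = "if m \<le> k then A * ?a (k - m) else 0"
      have u: "norm ?u * \<rho> ^ k \<le> norm A * \<rho> ^ m * M"
      proof (cases "m \<le> k")
        case True
        then have "norm ?u * \<rho> ^ k = norm A * \<rho> ^ m * b (k - m)"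
          by (simp add: b_def norm_mult power_add[symmetric])
        also have "\<dots> \<le> norm A * \<rho> ^ m * M"
          using less.IH[of "k - m"] n assms by (intro mult_left_mono) auto
        finally show ?thesis .
      qed (use assms M0 in auto)
      have v: "norm (B * ?a k) * \<rho> ^ k \<le> norm B * M"
        using less.IH[of k] n by (simp add: b_def norm_mult mult.assoc mult_left_mono)
      have "norm (?u + B * ?a k) * \<rho> ^ k \<le> (norm ?u + norm (B * ?a k)) * \<rho> ^ k"
        using assms by (intro mult_right_mono norm_triangle_ineq) auto
      also have "\<dots> \<le> (norm A * \<rho> ^ m + norm B) * M"
        using u v by (simp add: distrib_right)
      finally have w: "norm (?u + B * ?a k) * \<rho> ^ k * \<rho>\<^sup>2 \<le> (norm A * \<rho> ^ m + norm B) * M * \<rho>\<^sup>2"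
        by (intro mult_right_mono) auto
      have D: "norm (of_nat (Suc k) * of_nat (Suc (Suc k)) :: complex) = real (Suc k) * real (Suc (Suc k))"
        by (simp only: norm_mult norm_of_nat)
      have "b n = norm (?u + B * ?a k) * \<rho> ^ k * \<rho>\<^sup>2 / (real (Suc k) * real (Suc (Suc k)))"
        unfolding b_def n ode_coeff.simps norm_divide D by (simp add: power2_eq_square)
      also have "\<dots> \<le> K * M / (real (Suc k) * real (Suc (Suc k)))"
        using w by (intro divide_right_mono) (auto simp: K_def mult_ac)
      also have "\<dots> \<le> M"
      proof -
        have "K \<le> real (Suc k) * 1" using n0 k by simp
        also have "\<dots> \<le> real (Suc k) * real (Suc (Suc k))" by (intro mult_left_mono) auto
        finally have "K * M \<le> real (Suc k) * real (Suc (Suc k)) * M"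
          using M0 by (rule mult_right_mono)
        moreover have "0 < real (Suc k) * real (Suc (Suc k))" by (simp only: of_nat_0_less_iff zero_less_mult_iff) simp
        ultimately show ?thesis by (simp only: pos_divide_le_eq mult.commute)
      qed
      finally show ?thesis .
    qed (rule M1)
  qed
  then show ?thesis unfolding b_def by blast
qed

text \<open>Boundedness at the strictly larger radius \<open>norm z + 1\<close> feeds Abel's lemma,
  so the series is entire.\<close>

lemma summable_ode_coeff: "summable (\<lambda>n. ode_coeff A B m \<alpha> \<beta> n * z ^ n)"
proof -
  obtain M where "\<And>n. norm (ode_coeff A B m \<alpha> \<beta> n) * (norm z + 1) ^ n \<le> M"
    using ode_coeff_bounded[of "norm z + 1" A B m \<alpha> \<beta>] by (auto simp: add_nonneg_pos)
  then have "summable (\<lambda>n. norm (ode_coeff A B m \<alpha> \<beta> n) * norm z ^ n)"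
    by (intro Abel_lemma[of "norm z" "norm z + 1"]) auto
  then show ?thesis
    by - (rule summable_norm_cancel, simp add: norm_mult norm_power)
qed

text \<open>The entire power series is differentiated termwise and restricted to the real
  half-line.\<close>

lemma ode_sol_exists:
  "\<exists>w w'. ode_sol (\<lambda>x. A * complex_of_real x ^ m + B) w w' \<and> w 0 = \<alpha> \<and> w' 0 = \<beta>"
proof -
  let ?a = "ode_coeff A B m \<alpha> \<beta>"
  define f where "f z = (\<Sum>n. ?a n * z ^ n)" for z
  define g where "g z = (\<Sum>n. diffs ?a n * z ^ n)" for z
  have s1: "summable (\<lambda>n. diffs ?a n * z ^ n)" for z
    using termdiff_converges_all summable_ode_coeff by blast
  have f: "(f has_field_derivative g z) (at z)" for z
    unfolding f_def[abs_def] g_def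
    by (rule termdiffs_strong_converges_everywhere) (rule summable_ode_coeff)
  have g: "(g has_field_derivative (\<Sum>n. diffs (diffs ?a) n * z ^ n)) (at z)" for z
    unfolding g_def[abs_def] by (rule termdiffs_strong_converges_everywhere) (rule s1)
  have dd: "(\<Sum>n. diffs (diffs ?a) n * z ^ n) = (A * z ^ m + B) * f z" for z
  proof (rule sums_unique[symmetric])
    have sf: "(\<lambda>n. ?a n * z ^ n) sums f z"
      unfolding f_def using summable_ode_coeff by (rule summable_sums)
    \<comment> \<open>Coefficients of \<open>A * z ^ m * f z\<close>: the first \<open>m\<close>
      vanish, so shifting the index by \<open>m\<close> leaves the sum unchanged.\<close>
    let ?u = "\<lambda>n. (if m \<le> n then A * ?a (n - m) else 0) * z ^ n"
    have "(\<lambda>n. ?u (n + m)) sums (A * z ^ m * f z)"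
      using sums_mult[OF sf, of "A * z ^ m"] by (simp add: power_add mult_ac)
    then have "?u sums (A * z ^ m * f z)"
      by (subst (asm) sums_zero_iff_shift) auto
    from sums_add[OF this sums_mult[OF sf, of B]]
    have "(\<lambda>n. ?u n + B * (?a n * z ^ n)) sums ((A * z ^ m + B) * f z)"
      by (simp add: algebra_simps)
    moreover have "diffs (diffs ?a) n = (if m \<le> n then A * ?a (n - m) else 0) + B * ?a n" for n
      unfolding diffs_def ode_coeff.simps by (simp del: of_nat_Suc)
    ultimately show "(\<lambda>n. diffs (diffs ?a) n * z ^ n) sums ((A * z ^ m + B) * f z)"
      by (simp add: algebra_simps)
  qed
  have "ode_sol (\<lambda>x. A * complex_of_real x ^ m + B) (\<lambda>x. f (of_real x)) (\<lambda>x. g (of_real x))"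
    unfolding ode_sol_def using f g dd
    by (metis has_vector_derivative_real_field)
  moreover have "f 0 = \<alpha>" "g 0 = \<beta>"
    by (simp_all add: f_def g_def diffs_def)
  ultimately show ?thesis
    by (intro exI[of _ "\<lambda>x. f (of_real x)"] exI[of _ "\<lambda>x. g (of_real x)"]) simp
qed


subsection \<open>Integrability on half-lines\<close>

text \<open>The common product rule for the energies below, all built from real parts of
  sesquilinear expressions in \<open>w\<close> and \<open>w'\<close>.\<close>

lemma Re_mult_cnj_has_real_derivative:
  assumes "(f has_vector_derivative f') (at x within S)" "(g has_vector_derivative g') (at x within S)"
  shows "((\<lambda>x. Re (e * f x * cnj (g x))) has_real_derivative
           Re (e * (f' * cnj (g x) + f x * cnj g'))) (at x within S)"
proof -
  have "((\<lambda>x. e * (f x * cnj (g x))) has_vector_derivative e * (f x * cnj g' + f' * cnj (g x)))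
          (at x within S)"
    by (intro has_vector_derivative_mult_right has_vector_derivative_mult assms
          bounded_linear.has_vector_derivative[OF bounded_linear_cnj])
  from bounded_linear.has_vector_derivative[OF bounded_linear_Re this] show ?thesis
    by (simp add: has_real_derivative_iff_has_vector_derivative algebra_simps)
qed

lemma Re_mult_cnj_self: "Re (z * cnj z) = (norm z)\<^sup>2"
  by (simp only: complex_norm_square[symmetric] Re_complex_of_real)

text \<open>Monotone convergence for the truncations of \<open>f\<close> to
  \<open>{a..a + real n}\<close>, whose integrals stay below \<open>M\<close>.\<close>

lemma integrable_on_atLeast_if_bounded:
  fixes f :: "real \<Rightarrow> real"
  assumes cont: "continuous_on {a..} f" and nonneg: "\<And>x. a \<le> x \<Longrightarrow> 0 \<le> f x"
    and bound: "\<And>X. a \<le> X \<Longrightarrow> integral {a..X} f \<le> M"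
  shows "f integrable_on {a..}"
proof -
  let ?f = "\<lambda>n x. if x \<in> {a..a + real n} then f x else 0"
  have int: "f integrable_on {a..X}" for X
    by (rule integrable_continuous_real, rule continuous_on_subset[OF cont]) auto
  have sub: "{a..X} \<inter> {a..} = {a..X}" for X by auto
  have i: "?f n integrable_on {a..}" for n
    using int[of "a + real n"] by (simp only: integrable_restrict_Int sub)
  have e: "integral {a..} (?f n) = integral {a..a + real n} f" for n
    by (simp only: integral_restrict_Int sub)
  have "f integrable_on {a..} \<and> (\<lambda>n. integral {a..} (?f n)) \<longlonglongrightarrow> integral {a..} f"
  proof (rule monotone_convergence_increasing)
    show "?f n integrable_on {a..}" for n by (rule i)
    show "?f n x \<le> ?f (Suc n) x" if "x \<in> {a..}" for n x
      using that nonneg[of x] by auto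
    show "(\<lambda>n. ?f n x) \<longlonglongrightarrow> f x" if "x \<in> {a..}" for x
    proof (rule tendsto_eventually)
      obtain n0 where "x - a \<le> real n0" using real_arch_simple by blast
      then show "\<forall>\<^sub>F n in sequentially. ?f n x = f x"
        using that by (intro eventually_sequentiallyI[of n0]) auto
    qed
    have "0 \<le> integral {a..a + real n} f" for n
      by (rule integral_nonneg[OF int]) (use nonneg in auto)
    then show "bounded (range (\<lambda>n. integral {a..} (?f n)))"
      unfolding e by (intro boundedI[of _ M]) (auto simp: bound)
  qed
  then show ?thesis ..
qed

lemma integral_has_real_derivative_at:
  fixes f :: "real \<Rightarrow> real"
  assumes "continuous_on {a..} f" "a < x"
  shows "((\<lambda>u. integral {a..u} f) has_real_derivative f x) (at x)"
proof -
  have "at x within {a..} = at x"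
    using assms(2) by (intro at_within_interior) simp
  then show ?thesis
    using integral_has_vector_derivative_atLeast[OF assms(1), of x] assms(2)
    by (simp add: has_real_derivative_iff_has_vector_derivative)
qed

lemma continuous_on_integral_atLeast:
  fixes f :: "real \<Rightarrow> real"
  assumes "continuous_on {a..} f"
  shows "continuous_on {a..} (\<lambda>u. integral {a..u} f)"
  using integral_has_vector_derivative_atLeast[OF assms]
  by (auto simp: continuous_on_eq_continuous_within intro: has_vector_derivative_continuous)

text \<open>Beyond \<open>R\<close>, \<open>H\<close> is an antiderivative of a majorant of
  \<open>f\<close>. There \<open>H\<close> minus the indefinite integral of \<open>f\<close> is
  nondecreasing, so an upper bound on \<open>H\<close> bounds that integral.\<close>

lemma integrable_on_atLeast_if_derivative_bound:
  fixes f H h :: "real \<Rightarrow> real"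
  assumes cont: "continuous_on {a..} f" and nonneg: "\<And>x. a \<le> x \<Longrightarrow> 0 \<le> f x"
    and "a \<le> R" and H: "\<And>x. R < x \<Longrightarrow> (H has_real_derivative h x) (at x)"
    and Hc: "continuous_on {R..} H"
    and le: "\<And>x. R < x \<Longrightarrow> f x \<le> h x" and bd: "\<And>x. R \<le> x \<Longrightarrow> H x \<le> M"
  shows "f integrable_on {a..}"
proof (rule integrable_on_atLeast_if_bounded[OF cont nonneg])
  let ?F = "\<lambda>u. integral {a..u} f"
  have int: "f integrable_on {a..X}" for X
    by (rule integrable_continuous_real, rule continuous_on_subset[OF cont]) auto
  have nn: "0 \<le> ?F X" for X
    by (rule integral_nonneg[OF int]) (use nonneg in auto)
  have big: "?F X \<le> ?F R + (M - H R)" if "R \<le> X" for X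
  proof -
    have "H R - ?F R \<le> H X - ?F X"
    proof (rule DERIV_nonneg_imp_increasing_open[OF that])
      show "\<exists>y. DERIV (\<lambda>u. H u - ?F u) x :> y \<and> 0 \<le> y" if "R < x" "x < X" for x
        using \<open>a \<le> R\<close> le[of x] that
        by (intro exI[of _ "h x - f x"] conjI DERIV_diff H integral_has_real_derivative_at[OF cont]) auto
      show "continuous_on {R..X} (\<lambda>u. H u - ?F u)"
        using \<open>a \<le> R\<close>
        by (intro continuous_on_diff continuous_on_subset[OF Hc]
              continuous_on_subset[OF continuous_on_integral_atLeast[OF cont]]) auto
    qed
    then show ?thesis using bd[OF that] by simp
  qed
  show "?F X \<le> ?F R + (M - H R)" if "a \<le> X" for X
  proof (cases "R \<le> X")
    case False
    have "?F X \<le> ?F R"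
      by (rule integral_subset_le[OF _ int int]) (use False nonneg in auto)
    then show ?thesis using bd[of R] by simp
  qed (rule big)
qed

section \<open>Backward uniqueness and linear combinations\<close>

text \<open>Backward Gronwall argument: the energy \<open>e\<close> satisfies
  \<open>e' >= - (1 + K) * e\<close>, so \<open>e x * exp ((1 + K) * x)\<close> is nondecreasing,
  and it vanishes at \<open>R\<close>.\<close>

lemma ode_sol_unique_zero:
  assumes w: "ode_sol q w w'" and q: "continuous_on {0..} q" and "0 \<le> R" and "w R = 0" "w' R = 0"
    and x: "0 \<le> x" "x \<le> R"
  shows "w x = 0"
proof -
  have "bounded (q ` {0..R})"
    by (intro compact_imp_bounded compact_continuous_image continuous_on_subset[OF q]) auto
  then obtain K where K: "\<And>x. 0 \<le> x \<Longrightarrow> x \<le> R \<Longrightarrow> norm (q x) \<le> K"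
    unfolding bounded_iff by (metis atLeastAtMost_iff imageI)
  have K0: "0 \<le> K" using K[of R] \<open>0 \<le> R\<close> norm_ge_zero order_trans by blast
  \<comment> \<open>The factor 1 fits the pattern of
    \<open>Re_mult_cnj_has_real_derivative\<close>.\<close>
  define e where "e x = Re (1 * w x * cnj (w x)) + Re (1 * w' x * cnj (w' x))" for x
  have e: "e x = (norm (w x))\<^sup>2 + (norm (w' x))\<^sup>2" for x
    by (simp only: e_def mult_1_left Re_mult_cnj_self)
  have "e x * exp ((1 + K) * x) \<le> e R * exp ((1 + K) * R)"
  proof (rule DERIV_nonneg_imp_increasing_open[OF x(2)])
    have "continuous_on {0..} e"
      unfolding e_def by (intro continuous_intros ode_sol_continuous[OF w])
    then have "continuous_on {x..R} e"
      by (rule continuous_on_subset) (use x in auto)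
    then show "continuous_on {x..R} (\<lambda>x. e x * exp ((1 + K) * x))"
      by (intro continuous_intros)
  next
    fix y assume y: "x < y" "y < R"
    then have y0: "y > 0" using x by simp
    let ?D = "Re (1 * (w' y * cnj (w y) + w y * cnj (w' y))) +
              Re (1 * (q y * w y * cnj (w' y) + w' y * cnj (q y * w y)))"
    have "DERIV e y :> ?D"
      unfolding e_def
      by (intro DERIV_add Re_mult_cnj_has_real_derivative ode_sol_D[OF w y0])
    then have D: "DERIV (\<lambda>x. e x * exp ((1 + K) * x)) y :> (?D + (1 + K) * e y) * exp ((1 + K) * y)"
      by (auto intro!: derivative_eq_intros simp: algebra_simps)
    have sq: "2 * (norm (w y) * norm (w' y)) \<le> e y"
      unfolding e using sum_squares_bound[of "norm (w y)" "norm (w' y)"] by simp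
    have "?D = 2 * Re ((1 + q y) * (w y * cnj (w' y)))"
      by (simp add: algebra_simps)
    moreover have "\<bar>Re ((1 + q y) * (w y * cnj (w' y)))\<bar> \<le> (1 + K) * (norm (w y) * norm (w' y))"
    proof -
      have "\<bar>Re ((1 + q y) * (w y * cnj (w' y)))\<bar> \<le> norm ((1 + q y) * (w y * cnj (w' y)))"
        by (rule abs_Re_le_cmod)
      also have "\<dots> = norm (1 + q y) * (norm (w y) * norm (w' y))"
        by (simp add: norm_mult)
      also have "\<dots> \<le> (1 + K) * (norm (w y) * norm (w' y))"
        using norm_triangle_ineq[of 1 "q y"] K[of y] y y0 by (intro mult_right_mono) auto
      finally show ?thesis .
    qed
    moreover have "(1 + K) * (2 * (norm (w y) * norm (w' y))) \<le> (1 + K) * e y"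
      using sq K0 by (intro mult_left_mono) auto
    ultimately have "0 \<le> ?D + (1 + K) * e y" by simp
    then show "\<exists>z. DERIV (\<lambda>x. e x * exp ((1 + K) * x)) y :> z \<and> 0 \<le> z"
      using D by (meson exp_ge_zero mult_nonneg_nonneg)
  qed
  then have "e x * exp ((1 + K) * x) \<le> 0" using assms by (simp add: e)
  then have "e x \<le> 0" by (simp add: mult_le_0_iff)
  then show ?thesis
    by (simp add: e sum_power2_le_zero_iff)
qed

text \<open>Domination by \<open>|y + z|^2 <= 2 |y|^2 + 2 |z|^2\<close>; continuity makes the
  truncated integrals exist.\<close>

lemma square_integrable_lincomb:
  assumes "square_integrable {0..} u" "square_integrable {0..} v"
    and "continuous_on {0..} u" "continuous_on {0..} v"
  shows "square_integrable {0..} (\<lambda>x. a * u x + b * v x)"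
proof -
  let ?g = "\<lambda>x. 2 * (norm a)\<^sup>2 * (norm (u x))\<^sup>2 + 2 * (norm b)\<^sup>2 * (norm (v x))\<^sup>2"
  let ?f = "\<lambda>x. (norm (a * u x + b * v x))\<^sup>2"
  have g: "?g integrable_on {0..}"
    using assms unfolding square_integrable_def
    by (intro integrable_add integrable_on_mult_right)
  have le: "?f x \<le> ?g x" for x
  proof -
    have "?f x \<le> (norm (a * u x) + norm (b * v x))\<^sup>2"
      by (intro power_mono norm_triangle_ineq) auto
    also have "\<dots> \<le> 2 * (norm (a * u x))\<^sup>2 + 2 * (norm (b * v x))\<^sup>2"
      using sum_squares_bound[of "norm (a * u x)" "norm (b * v x)"] by (simp add: power2_sum)
    finally show ?thesis by (simp add: norm_mult power_mult_distrib)
  qed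
  have cf: "continuous_on {0..} ?f"
    by (intro continuous_intros assms)
  have cg: "continuous_on {0..} ?g"
    by (intro continuous_intros assms)
  have "?f integrable_on {0..}"
  proof (rule integrable_on_atLeast_if_bounded[OF cf])
    fix X :: real
    have i1: "?f integrable_on {0..X}"
      by (rule integrable_continuous_real, rule continuous_on_subset[OF cf]) auto
    have i2: "?g integrable_on {0..X}"
      by (rule integrable_continuous_real, rule continuous_on_subset[OF cg]) auto
    have "integral {0..X} ?f \<le> integral {0..X} ?g"
      by (rule integral_le[OF i1 i2]) (rule le)
    also have "\<dots> \<le> integral {0..} ?g"
      by (rule integral_subset_le[OF _ i2 g]) auto
    finally show "integral {0..X} ?f \<le> integral {0..} ?g" .
  qed auto
  then show ?thesis by (simp add: square_integrable_def)
qed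

subsection \<open>Sectorial potentials\<close>

text \<open>Setting of the limit-point case: multiplication by \<open>e\<close> moves both 1 and the
  values \<open>q x\<close>, for large \<open>x\<close>, into a half-plane
  \<open>Re >= d > 0\<close>. This makes the derivative of \<open>form\<close> coercive.\<close>

locale sectorial_ode =
  fixes q :: "real \<Rightarrow> complex" and e :: complex and d R :: real
  assumes continuous_q: "continuous_on {0..} q"
    and d_pos: "d > 0" and R_nonneg: "R \<ge> 0" and Re_e: "Re e \<ge> d"
    and Re_eq: "\<And>x. x \<ge> R \<Longrightarrow> Re (e * q x) \<ge> d"
begin

text \<open>The boundary term that appears when the equation is multiplied by
  \<open>e * cnj w\<close> and integrated by parts.\<close>

definition form :: "(real \<Rightarrow> complex) \<Rightarrow> (real \<Rightarrow> complex) \<Rightarrow> real \<Rightarrow> real" where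
  "form w w' x = Re (e * w' x * cnj (w x))"

context
  fixes w w' :: "real \<Rightarrow> complex"
  assumes w: "ode_sol q w w'"
begin

lemma form_deriv:
  assumes "R < x"
  shows "(form w w' has_real_derivative
           Re e * (norm (w' x))\<^sup>2 + Re (e * q x) * (norm (w x))\<^sup>2) (at x)"
proof -
  have x: "x > 0" using assms R_nonneg by simp
  have "Re (e * (q x * w x * cnj (w x) + w' x * cnj (w' x))) =
        Re (e * q x * of_real ((norm (w x))\<^sup>2) + e * of_real ((norm (w' x))\<^sup>2))"
    by (simp only: complex_norm_square distrib_left mult.assoc)
  also have "\<dots> = Re e * (norm (w' x))\<^sup>2 + Re (e * q x) * (norm (w x))\<^sup>2"
    by (simp only: plus_complex.sel Re_complex_of_real times_complex.sel Im_complex_of_real)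
  finally show ?thesis
    using Re_mult_cnj_has_real_derivative[OF ode_sol_D(2)[OF w x] ode_sol_D(1)[OF w x], of e]
    unfolding form_def[abs_def] by (simp only:)
qed

lemma form_deriv_ge:
  assumes "R < x"
  shows "d * ((norm (w' x))\<^sup>2 + (norm (w x))\<^sup>2) \<le>
           Re e * (norm (w' x))\<^sup>2 + Re (e * q x) * (norm (w x))\<^sup>2"
  unfolding distrib_left using Re_e Re_eq[of x] assms by (intro add_mono mult_right_mono) auto

lemma form_deriv_nonneg:
  assumes "R < x"
  shows "0 \<le> Re e * (norm (w' x))\<^sup>2 + Re (e * q x) * (norm (w x))\<^sup>2"
  by (rule order_trans[OF _ form_deriv_ge[OF assms]]) (use d_pos in auto)

lemma continuous_form: "continuous_on {0..} (form w w')"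
  unfolding form_def by (intro continuous_intros ode_sol_continuous[OF w])

lemma form_mono:
  assumes "R \<le> x" "x \<le> y"
  shows "form w w' x \<le> form w w' y"
proof (rule DERIV_nonneg_imp_increasing_open[OF assms(2)])
  show "\<exists>D. DERIV (form w w') z :> D \<and> 0 \<le> D" if "x < z" "z < y" for z
    using form_deriv[of z] form_deriv_nonneg[of z] that assms by auto
  show "continuous_on {x..y} (form w w')"
    by (rule continuous_on_subset[OF continuous_form]) (use assms R_nonneg in auto)
qed

lemma continuous_norm_sq: "continuous_on {0..} (\<lambda>x. (norm (w x))\<^sup>2)"
  by (intro continuous_intros ode_sol_continuous[OF w])

text \<open>Coercivity makes \<open>form w w' x / d\<close> an antiderivative of a majorant of
  \<open>|w|^2\<close>, and by assumption it is bounded above by 0.\<close>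

lemma square_integrable_if_form_nonpos:
  assumes "\<And>x. R \<le> x \<Longrightarrow> form w w' x \<le> 0"
  shows "square_integrable {0..} w"
  unfolding square_integrable_def
proof (rule integrable_on_atLeast_if_derivative_bound[OF continuous_norm_sq _ R_nonneg])
  let ?h = "\<lambda>x. (Re e * (norm (w' x))\<^sup>2 + Re (e * q x) * (norm (w x))\<^sup>2) / d"
  show "((\<lambda>x. form w w' x / d) has_real_derivative ?h x) (at x)" if "R < x" for x
    using form_deriv[OF that] by (rule DERIV_cdivide)
  show "(norm (w x))\<^sup>2 \<le> ?h x" if "R < x" for x
  proof -
    have "d * (norm (w x))\<^sup>2 \<le> d * ((norm (w' x))\<^sup>2 + (norm (w x))\<^sup>2)"
      using d_pos by (intro mult_left_mono) auto
    with form_deriv_ge[OF that] show ?thesis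
      using d_pos by (simp only: pos_le_divide_eq mult.commute[of _ d])
  qed
  show "continuous_on {R..} (\<lambda>x. form w w' x / d)"
    by (intro continuous_intros continuous_on_subset[OF continuous_form]) (use d_pos R_nonneg in auto)
  show "form w w' x / d \<le> 0" if "R \<le> x" for x
    using assms[OF that] d_pos by (simp add: divide_le_0_iff)
qed auto

text \<open>If the form \<open>G\<close> is positive somewhere, then Cauchy--Schwarz gives \<open>|w|\<^sup>2 \<ge> c G\<^sup>2 / G'\<close>, and
  \<open>c / h \<ge> c (2 - h)\<close> for \<open>h = G' / G\<^sup>2\<close>, whose integral \<open>1/G(a) - 1/G(x)\<close> stays bounded.\<close>

lemma form_nonpos_if_square_integrable:
  assumes L2: "square_integrable {0..} w" and "R \<le> a"
  shows "form w w' a \<le> 0"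
proof (rule ccontr)
  let ?G = "form w w'" and ?f = "\<lambda>x. (norm (w x))\<^sup>2"
  let ?G' = "\<lambda>x. Re e * (norm (w' x))\<^sup>2 + Re (e * q x) * (norm (w x))\<^sup>2"
  let ?F = "\<lambda>x. integral {0..x} ?f"
  assume "\<not> ?G a \<le> 0"
  then have pos: "?G x > 0" if "a \<le> x" for x
    using form_mono[OF \<open>R \<le> a\<close> that] by simp
  have e0: "norm e > 0" using Re_e d_pos by auto
  \<comment> \<open>From \<open>|G| <= norm e * |w'| * |w|\<close> and
    \<open>d * |w'|^2 <= G'\<close> follows \<open>c * G^2 <= G' * |w|^2\<close> with this
    constant.\<close>
  define c where "c = d / (norm e)\<^sup>2"
  have c0: "c > 0" using d_pos e0 by (simp add: c_def)
  have F_le: "?F X \<le> integral {0..} ?f" for X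
    using L2 unfolding square_integrable_def
    by (intro integral_subset_le integrable_continuous_real continuous_on_subset[OF continuous_norm_sq]) auto
  \<comment> \<open>The difference has derivative \<open>|w|^2 - c * (2 - G' / G^2)\<close>, so this
    is the pointwise bound integrated from \<open>a\<close> to \<open>X\<close>.\<close>
  have F_ge: "?F a - c * (2 * a + inverse (?G a)) \<le> ?F X - c * (2 * X + inverse (?G X))" if "a \<le> X" for X
  proof (rule DERIV_nonneg_imp_increasing_open[OF that])
    show "continuous_on {a..X} (\<lambda>x. ?F x - c * (2 * x + inverse (?G x)))"
      using \<open>R \<le> a\<close> R_nonneg pos
      by (intro continuous_intros continuous_on_subset[OF continuous_form]
            continuous_on_subset[OF continuous_on_integral_atLeast[OF continuous_norm_sq]]) force+
    fix x assume x: "a < x" "x < X"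
    then have Rx: "R < x" "0 < x" using \<open>R \<le> a\<close> R_nonneg by auto
    have Gx: "?G x > 0" using pos x by simp
    have D: "DERIV (\<lambda>x. ?F x - c * (2 * x + inverse (?G x))) x :>
          ?f x - c * (2 * 1 + - (inverse (?G x) * ?G' x * inverse (?G x)))"
      using Gx
      by (intro DERIV_diff DERIV_cmult DERIV_add DERIV_ident DERIV_inverse' form_deriv Rx
            integral_has_real_derivative_at[OF continuous_norm_sq]) auto
    have "c * (2 - ?G' x / (?G x)\<^sup>2) \<le> ?f x"
    proof -
      have "\<bar>?G x\<bar> \<le> norm e * norm (w' x) * norm (w x)"
        unfolding form_def using abs_Re_le_cmod[of "e * w' x * cnj (w x)"] by (simp add: norm_mult)
      then have "(?G x)\<^sup>2 \<le> (norm e * norm (w' x) * norm (w x))\<^sup>2"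
        by (metis abs_le_square_iff abs_of_nonneg mult_nonneg_nonneg norm_ge_zero)
      then have "d * (?G x)\<^sup>2 \<le> (norm e)\<^sup>2 * (d * (norm (w' x))\<^sup>2) * ?f x"
        using d_pos by (simp add: power_mult_distrib mult_ac mult_left_mono)
      also have "\<dots> \<le> (norm e)\<^sup>2 * ?G' x * ?f x"
      proof (intro mult_right_mono mult_left_mono)
        have "d * (norm (w' x))\<^sup>2 \<le> d * ((norm (w' x))\<^sup>2 + (norm (w x))\<^sup>2)"
          using d_pos by (intro mult_left_mono) auto
        then show "d * (norm (w' x))\<^sup>2 \<le> ?G' x" using form_deriv_ge[OF Rx(1)] by simp
      qed auto
      finally have "c * (?G x)\<^sup>2 \<le> ?G' x * ?f x"
        using e0 by (simp add: c_def field_simps)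
      define h where "h = ?G' x / (?G x)\<^sup>2"
      have hf: "c \<le> h * ?f x"
        using \<open>c * (?G x)\<^sup>2 \<le> ?G' x * ?f x\<close> Gx by (simp add: h_def field_simps)
      have h0: "h > 0"
        using hf c0 form_deriv_nonneg[OF Rx(1)] by (cases "h = 0") (auto simp: h_def less_le)
      \<comment> \<open>This is \<open>h * (2 - h) <= 1\<close>; together with
        \<open>c <= h * |w|^2\<close>, division by \<open>h > 0\<close> gives the bound.\<close>
      have "h * (c * (2 - h)) = c * (1 - (1 - h)\<^sup>2)"
        by (simp add: power2_eq_square algebra_simps)
      also have "\<dots> \<le> c * 1" using c0 by (intro mult_left_mono) auto
      also have "\<dots> \<le> h * ?f x" using hf by simp
      finally show ?thesis
        using h0 unfolding h_def[symmetric] by simp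
    qed
    then have "0 \<le> ?f x - c * (2 * 1 + - (inverse (?G x) * ?G' x * inverse (?G x)))"
      by (simp add: power2_eq_square divide_inverse mult_ac)
    with D show "\<exists>y. DERIV (\<lambda>x. ?F x - c * (2 * x + inverse (?G x))) x :> y \<and> 0 \<le> y"
      by blast
  qed
  define C where "C = integral {0..} ?f - ?F a + c * (2 * a + inverse (?G a))"
  have "2 * c * X \<le> C" if "a \<le> X" for X
  proof -
    have "0 \<le> c * inverse (?G X)" using pos[OF that] c0 by simp
    then show ?thesis using F_ge[OF that] F_le[of X] by (simp add: C_def algebra_simps)
  qed
  \<comment> \<open>A point beyond \<open>a\<close> at which the linear growth has overtaken
    \<open>C\<close>.\<close>
  from this[of "max a (C / (2 * c) + 1)"] have "2 * c * (C / (2 * c) + 1) \<le> C"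
    using c0 by (smt (verit) max.cobounded1 max.cobounded2 mult_left_mono)
  then have "2 * c \<le> 0" using c0 by (simp add: distrib_left)
  then show False using c0 by simp
qed

text \<open>The form is 0 at \<open>R\<close>, nondecreasing and nonpositive, hence identically 0
  beyond \<open>R\<close>; coercivity of its derivative then kills \<open>w\<close> there, and
  backward uniqueness carries this down to 0.\<close>

lemma zero_if_square_integrable:
  assumes L2: "square_integrable {0..} w" and "w R = 0" and "0 \<le> x"
  shows "w x = 0"
proof -
  have G0: "form w w' y = 0" if "R \<le> y" for y
    using form_mono[of R y] form_nonpos_if_square_integrable[OF L2 that] that \<open>w R = 0\<close>
    by (simp add: form_def)
  have z: "w y = 0" if "R < y" for y
  proof -
    have "DERIV (form w w') y :> 0"
      by (rule has_field_derivative_transform_within_open[OF DERIV_const[of 0], of "{R<..}"])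
         (use that G0 in auto)
    then have "Re e * (norm (w' y))\<^sup>2 + Re (e * q y) * (norm (w y))\<^sup>2 = 0"
      using form_deriv[OF that] DERIV_unique by blast
    then have "d * ((norm (w' y))\<^sup>2 + (norm (w y))\<^sup>2) \<le> 0"
      using form_deriv_ge[OF that] by simp
    then have "(norm (w' y))\<^sup>2 + (norm (w y))\<^sup>2 \<le> 0"
      using d_pos by (simp add: mult_le_0_iff)
    then show ?thesis
      by (simp add: sum_power2_le_zero_iff)
  qed
  then have z': "w y = 0" if "R \<le> y" for y
    using that \<open>w R = 0\<close> by (cases "y = R") auto
  show ?thesis
  proof (cases "R < x")
    case False
    \<comment> \<open>\<open>R + 1\<close> is interior to the region where \<open>w\<close> is known
      to vanish, so the derivative vanishes as well.\<close>
    have "w' (R + 1) = 0"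
    proof -
      have "(w has_vector_derivative 0) (at (R + 1))"
        by (rule has_vector_derivative_transform_within_open[OF has_vector_derivative_const[of 0], where S = "{R<..}"])
           (use z in auto)
      then show ?thesis
        using ode_sol_D(1)[OF w, of "R + 1"] R_nonneg vector_derivative_unique_at by fastforce
    qed
    then show ?thesis
      using ode_sol_unique_zero[OF w continuous_q, of "R + 1" x] z[of "R + 1"] R_nonneg False \<open>0 \<le> x\<close>
      by simp
  qed (rule z)
qed

end

text \<open>Weyl's construction: take the solution vanishing at \<open>n\<close>, normalise its initial data, and let
  \<open>n\<close> tend to infinity along a subsequence; nonpositivity of the form survives the limit.\<close>

lemma exists_square_integrable:
  assumes u: "ode_sol q u u'" "u 0 = 1" "u' 0 = 0" and v: "ode_sol q v v'" "v 0 = 0" "v' 0 = 1"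
  shows "\<exists>w w'. ode_sol q w w' \<and> square_integrable {0..} w \<and> (\<exists>x\<ge>0. w x \<noteq> 0)"
proof -
  \<comment> \<open>One linear condition on two unknowns has a nonzero solution; any unit vector
    serves when both values vanish.\<close>
  have "\<exists>p::complex\<times>complex. norm p = 1 \<and> fst p * u (real n) + snd p * v (real n) = 0" for n
  proof (cases "u n = 0 \<and> v n = 0")
    case True
    then show ?thesis by (intro exI[of _ "(1, 0)"]) (simp add: norm_Pair)
  next
    case False
    define p where "p = (v n, - u n)"
    have "p \<noteq> 0" using False by (auto simp: p_def zero_prod_def)
    then have "norm (p /\<^sub>R norm p) = 1" by simp
    moreover have "fst (p /\<^sub>R norm p) * u n + snd (p /\<^sub>R norm p) * v n = 0"
      by (simp add: p_def)
    ultimately show ?thesis by blast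
  qed
  then obtain P :: "nat \<Rightarrow> complex \<times> complex"
    where P: "\<And>n. norm (P n) = 1" "\<And>n. fst (P n) * u (real n) + snd (P n) * v (real n) = 0"
    by metis
  have "compact (sphere (0 :: complex \<times> complex) 1)" by simp
  moreover have "\<forall>n. P n \<in> sphere 0 1" using P by simp
  ultimately obtain l r where l: "l \<in> sphere (0 :: complex \<times> complex) 1" and r: "strict_mono r"
    and lim: "(P \<circ> r) \<longlonglongrightarrow> l"
    unfolding compact_def by metis
  define W where "W p = (\<lambda>x. fst p * u x + snd p * v x)" for p :: "complex \<times> complex"
  define W' where "W' p = (\<lambda>x. fst p * u' x + snd p * v' x)" for p :: "complex \<times> complex"
  have W: "ode_sol q (W p) (W' p)" for p
    unfolding W_def W'_def by (rule ode_sol_lincomb[OF u(1) v(1)])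
  have "form (W l) (W' l) x \<le> 0" if "R \<le> x" for x
  proof (rule tendsto_upperbound)
    show "(\<lambda>k. form (W ((P \<circ> r) k)) (W' ((P \<circ> r) k)) x) \<longlonglongrightarrow> form (W l) (W' l) x"
      unfolding form_def W_def W'_def by (intro tendsto_intros lim)
    obtain n0 where n0: "x \<le> real n0" using real_arch_simple by blast
    have "form (W (P (r k))) (W' (P (r k))) x \<le> 0" if "n0 \<le> k" for k
    proof -
      \<comment> \<open>\<open>r k >= k >= n0\<close>, so the point where the approximating
        solution, and with it its form, vanishes lies to the right of \<open>x\<close>.\<close>
      have "x \<le> real (r k)"
        using n0 that seq_suble[OF r, of k] by linarith
      then have "form (W (P (r k))) (W' (P (r k))) x \<le> form (W (P (r k))) (W' (P (r k))) (real (r k))"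
        by (rule form_mono[OF W \<open>R \<le> x\<close>])
      also have "\<dots> = 0" using P(2)[of "r k"] by (simp add: form_def W_def)
      finally show ?thesis .
    qed
    then show "\<forall>\<^sub>F k in sequentially. form (W ((P \<circ> r) k)) (W' ((P \<circ> r) k)) x \<le> 0"
      by (intro eventually_sequentiallyI[of n0]) simp
  qed simp
  then have "square_integrable {0..} (W l)"
    by (rule square_integrable_if_form_nonpos[OF W])
  moreover have "\<exists>x\<ge>0. W l x \<noteq> 0"
  proof (rule ccontr)
    assume "\<not> (\<exists>x\<ge>0. W l x \<noteq> 0)"
    then have z: "W l x = 0" if "x \<ge> 0" for x using that by blast
    have "(W l has_vector_derivative 0) (at 0 within {0..})"
      by (rule has_vector_derivative_transform[OF _ _ has_vector_derivative_const[of 0]]) (use z in auto)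
    moreover have "(W l has_vector_derivative W' l 0) (at 0 within {0..})"
      using W unfolding ode_sol_def by blast
    ultimately have "W' l 0 = 0"
      by (metis at_within_Ici_at_right vector_derivative_unique_within trivial_limit_at_right_real)
    \<comment> \<open>The components of \<open>l\<close> are the initial data of \<open>W l\<close>,
      so a trivial limit would have norm 0 instead of 1.\<close>
    then have "l = 0"
      using z[of 0] u v by (simp add: W_def W'_def prod_eq_iff)
    then show False using l by simp
  qed
  ultimately show ?thesis using W by blast
qed

text \<open>Subtracting the multiple of \<open>w0\<close> that matches \<open>w\<close> at
  \<open>R\<close> leaves a square integrable solution vanishing at \<open>R\<close>.\<close>

lemma square_integrable_proportional:
  assumes w0: "ode_sol q w0 w0'" "square_integrable {0..} w0" "\<exists>x\<ge>0. w0 x \<noteq> 0"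
    and w: "ode_sol q w w'" "square_integrable {0..} w"
  shows "\<exists>a. \<forall>x\<ge>0. w x = a * w0 x"
proof -
  have nz: "w0 R \<noteq> 0" using zero_if_square_integrable[OF w0(1,2)] w0(3) by blast
  let ?a = "w R / w0 R"
  have "square_integrable {0..} (\<lambda>x. 1 * w x + (- ?a) * w0 x)"
    by (intro square_integrable_lincomb w w0 ode_sol_continuous(1)[OF w(1)] ode_sol_continuous(1)[OF w0(1)])
  then have "1 * w x + (- ?a) * w0 x = 0" if "x \<ge> 0" for x
    by (rule zero_if_square_integrable[OF ode_sol_lincomb[OF w(1) w0(1)]]) (use nz that in auto)
  then show ?thesis by (intro exI[of _ ?a]) (simp add: algebra_simps)
qed

end

subsection \<open>Oscillatory potentials\<close>

text \<open>The WKB energy \<open>|w'|\<^sup>2/P + P|w|\<^sup>2\<close> with \<open>P = x\<^bsup>m/2\<^esup>\<close>; the cross term removes the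
  nonintegrable part of its logarithmic derivative.\<close>

lemma square_integrable_oscillatory:
  assumes sol: "ode_sol (\<lambda>x. - (complex_of_real x ^ m) + B) w w'" and "m \<ge> 3"
  shows "square_integrable {0..} w"
proof -
  define s where "s = real m / 2"
  have s: "s \<ge> 3/2" using \<open>m \<ge> 3\<close> by (simp add: s_def)
  define a where "a x = Re (1 * w x * cnj (w x))" for x
  define b where "b x = Re (1 * w' x * cnj (w' x))" for x
  define r where "r x = Re (1 * w x * cnj (w' x))" for x
  have a: "a x = (norm (w x))\<^sup>2" and b: "b x = (norm (w' x))\<^sup>2" for x
    by (simp_all only: a_def b_def mult_1_left Re_mult_cnj_self)
  have ab0: "a x \<ge> 0" "b x \<ge> 0" for x by (simp_all add: a b)
  define \<beta> where "\<beta> x = Re (B * (w x * cnj (w' x)))" for x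
  \<comment> \<open>With \<open>P = x powr s\<close>, differentiating the two weights produces
    \<open>s * x powr (-s - 1) * (P^2 * a - b)\<close>. Since
    \<open>r' = b + (Re B - P^2) * a\<close>, the last summand of \<open>E\<close> cancels
    it.\<close>
  define E where "E x = b x * x powr (-s) + a x * x powr s + s * (r x * x powr (-s - 1))" for x
  define E0 where "E0 x = b x * x powr (-s) + a x * x powr s" for x
  \<comment> \<open>The derivative of \<open>E\<close> after this cancellation; every remaining term
    carries the decaying factor \<open>x powr (-s)\<close>.\<close>
  define E1 where "E1 x = 2 * x powr (-s) * \<beta> x + s * Re B * a x * (x powr (-s) / x)
                            - s * (s + 1) * r x * (x powr (-s) / x\<^sup>2)" for x
  \<comment> \<open>One summand for each of the estimates \<open>T1\<close>, \<open>T2\<close>,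
    \<open>T3\<close>.\<close>
  define K where "K = norm B + s * norm B + s * (s + 1) / 2"
  have K0: "K \<ge> 0" using s by (simp add: K_def)
  have E0_nonneg: "E0 x \<ge> 0" for x using ab0 by (simp add: E0_def)
  have deriv: "DERIV E x :> E1 x" if x: "x > 0" for x
  proof -
    note d = ode_sol_D[OF sol x]
    define P where "P = x powr s"
    define p where "p = x powr (-s)"
    have Pp: "P * p = 1" using x by (simp add: P_def p_def powr_add[symmetric])
    have PP: "P * P = x ^ m" using x by (simp add: P_def s_def powr_add[symmetric] powr_realpow)
    have pw: "x powr (-s - 1) = p / x" "x powr (s - 1) = P / x" "x powr (-s - 1 - 1) = p / x\<^sup>2"
      using x by (simp_all only: P_def p_def powr_diff powr_one less_imp_le power2_eq_square divide_divide_eq_left)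
    let ?q = "- (complex_of_real x ^ m) + B"
    have q: "?q = of_real (- (P * P)) + B" unfolding PP by simp
    have da: "DERIV a x :> 2 * r x"
      unfolding a_def r_def
      by (rule DERIV_cong[OF Re_mult_cnj_has_real_derivative[OF d(1) d(1)]]) (simp add: algebra_simps)
    have db: "DERIV b x :> - 2 * (P * P) * r x + 2 * \<beta> x"
      unfolding b_def r_def \<beta>_def
      by (rule DERIV_cong[OF Re_mult_cnj_has_real_derivative[OF d(2) d(2)]], unfold q)
         (simp add: algebra_simps)
    have dr: "DERIV r x :> b x + (Re B - P * P) * a x"
      unfolding b_def r_def a_def
      by (rule DERIV_cong[OF Re_mult_cnj_has_real_derivative[OF d(1) d(2)]], unfold q)
         (simp add: algebra_simps)
    have "DERIV E x :>
        ((- 2 * (P * P) * r x + 2 * \<beta> x) * p + (- s * x powr (-s - 1)) * b x)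
        + ((2 * r x) * P + (s * x powr (s - 1)) * a x)
        + s * ((b x + (Re B - P * P) * a x) * x powr (-s - 1) + ((-s - 1) * x powr (-s - 1 - 1)) * r x)"
      unfolding E_def P_def p_def
      by (intro DERIV_add DERIV_mult DERIV_cmult has_real_derivative_powr x da[unfolded P_def]
            db[unfolded P_def] dr[unfolded P_def])
    then show ?thesis
    proof (rule DERIV_cong)
      define u where "u = p / x"
      define v where "v = p / x\<^sup>2"
      have e1: "P * P * p = P" using Pp by (simp add: mult.assoc)
      then have e2: "P / x = P * P * u" by (simp add: u_def)
      have "((- 2 * (P * P) * r x + 2 * \<beta> x) * p + (- s * u) * b x)
        + ((2 * r x) * P + (s * (P * P * u)) * a x)
        + s * ((b x + (Re B - P * P) * a x) * u + ((-s - 1) * v) * r x)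
        = 2 * p * \<beta> x + s * Re B * a x * u - s * (s + 1) * r x * v + 2 * r x * (P - P * P * p)"
        by (simp add: algebra_simps)
      also have "\<dots> = E1 x"
        by (simp add: e1 E1_def p_def[symmetric] u_def v_def)
      finally show "((- 2 * (P * P) * r x + 2 * \<beta> x) * p + (- s * x powr (-s - 1)) * b x)
        + ((2 * r x) * P + (s * x powr (s - 1)) * a x)
        + s * ((b x + (Re B - P * P) * a x) * x powr (-s - 1) + ((-s - 1) * x powr (-s - 1 - 1)) * r x)
        = E1 x"
        unfolding pw u_def[symmetric] v_def[symmetric] e2 .
    qed
  qed
  \<comment> \<open>The range \<open>x >= s\<close> makes the cross term at most half of
    \<open>E0 x\<close>, and \<open>s >= 3/2\<close>, that is \<open>m >= 3\<close>, yields the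
    integrable rate \<open>x powr (- 3/2)\<close>.\<close>
  have est: "E1 x \<le> 2 * K * x powr (- 3/2) * E x" "E0 x \<le> 2 * E x" "a x \<le> x powr (- 3/2) * E0 x"
    if "s \<le> x" for x
  proof -
    have x: "x \<ge> 1" "x > 0" using that s by auto
    define P where "P = x powr s"
    define p where "p = x powr (-s)"
    define y where "y = x powr (- 3/2)"
    have Pp: "P * p = 1" using x by (simp add: P_def p_def powr_add[symmetric])
    have p0: "p > 0" using x by (simp add: p_def)
    have py: "p \<le> y" unfolding p_def y_def using x s by (intro powr_mono) auto
    have y1: "y \<le> 1" unfolding y_def using x powr_mono[of "-3/2" 0 x] by simp
    have p1: "p \<le> 1" using py y1 by simp
    have e0: "E0 x = b x * p + a x * P" by (simp add: E0_def p_def P_def)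
    define t where "t = norm (w x) * norm (w' x)"
    \<comment> \<open>Expanding the square with \<open>P * p = 1\<close> gives the
      arithmetic-geometric bound \<open>2 * t <= E0 x\<close>.\<close>
    have "0 \<le> p * (norm (w' x) - P * norm (w x))\<^sup>2" using p0 by simp
    also have "\<dots> = b x * p - 2 * (P * p) * t + a x * P * (P * p)"
      by (simp add: a b t_def power2_eq_square algebra_simps)
    finally have t: "2 * t \<le> E0 x" by (simp add: Pp e0)
    have r: "\<bar>r x\<bar> \<le> t"
      unfolding r_def t_def using abs_Re_le_cmod[of "w x * cnj (w' x)"] by (simp add: norm_mult)
    have \<beta>: "\<beta> x \<le> norm B * t"
      unfolding \<beta>_def t_def using complex_Re_le_cmod[of "B * (w x * cnj (w' x))"] by (simp add: norm_mult)
    have "a x * (P * p) \<le> E0 x * p" unfolding e0 using ab0 p0 by (simp add: algebra_simps)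
    then have ap: "a x \<le> p * E0 x" by (simp add: Pp mult.commute)
    also have "\<dots> \<le> y * E0 x" using py E0_nonneg by (intro mult_right_mono)
    finally show "a x \<le> x powr (- 3/2) * E0 x" by (simp add: y_def)
    have "a x \<le> 1 * E0 x" by (rule order_trans[OF ap]) (intro mult_right_mono p1 E0_nonneg)
    then have aE: "a x \<le> E0 x" by simp
    have px: "p / x \<le> p" "p / x\<^sup>2 \<le> p" "0 \<le> p / x" "0 \<le> p / x\<^sup>2"
      using x p0 by (auto simp: divide_le_eq mult_le_cancel_left1)
    have "s * (p / x) \<le> 1"
    proof -
      have "s * p \<le> x * 1" using that p1 p0 s by (intro mult_mono) auto
      then show ?thesis using x by (simp add: divide_le_eq)
    qed
    then have "s * (p / x) * \<bar>r x\<bar> \<le> 1 * t" using r px(3) s by (intro mult_mono) auto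
    moreover have "- (s * (p / x) * r x) \<le> s * (p / x) * \<bar>r x\<bar>"
    proof -
      have "0 \<le> s * (p / x)" using px(3) s by (intro mult_nonneg_nonneg) auto
      from mult_left_mono[OF _ this, of "- r x" "\<bar>r x\<bar>"] show ?thesis by simp
    qed
    moreover have "E x = E0 x + s * (p / x) * r x"
      using x by (simp add: E_def E0_def p_def powr_diff)
    ultimately show E: "E0 x \<le> 2 * E x" using t by linarith
    have T1: "2 * p * \<beta> x \<le> norm B * (p * E0 x)"
    proof -
      have "2 * p * \<beta> x \<le> 2 * p * (norm B * t)" using \<beta> p0 by (intro mult_left_mono) auto
      also have "\<dots> = norm B * p * (2 * t)" by simp
      also have "\<dots> \<le> norm B * p * E0 x" using t p0 by (intro mult_left_mono) auto
      finally show ?thesis by simp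
    qed
    have T2: "s * Re B * a x * (p / x) \<le> s * norm B * (p * E0 x)"
    proof -
      have "s * Re B * a x * (p / x) \<le> s * norm B * a x * (p / x)"
        using s ab0 px(3) complex_Re_le_cmod by (intro mult_right_mono mult_left_mono) auto
      also have "\<dots> \<le> s * norm B * E0 x * p"
        using s ab0 px aE E0_nonneg by (intro mult_mono) auto
      finally show ?thesis by (simp add: mult_ac)
    qed
    have T3: "- (s * (s + 1) * r x * (p / x\<^sup>2)) \<le> s * (s + 1) / 2 * (p * E0 x)"
    proof -
      have "s * (s + 1) * (- r x) * (p / x\<^sup>2) \<le> s * (s + 1) * (E0 x / 2) * (p / x\<^sup>2)"
        using s px(4) r t by (intro mult_right_mono mult_left_mono) auto
      also have "\<dots> \<le> s * (s + 1) * (E0 x / 2) * p"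
        using s px(2) E0_nonneg by (intro mult_left_mono) auto
      finally show ?thesis by (simp add: mult_ac)
    qed
    have "E1 x \<le> K * (p * E0 x)"
      using T1 T2 T3 unfolding E1_def p_def[symmetric] K_def distrib_right by linarith
    also have "\<dots> \<le> K * (y * (2 * E x))"
      using K0 py E p0 E0_nonneg by (intro mult_left_mono mult_mono) auto
    finally show "E1 x \<le> 2 * K * x powr (- 3/2) * E x" by (simp add: y_def mult_ac)
  qed
  define M where "M = E s * exp (4 * K * s powr (- 1/2))"
  have s0: "s > 0" using s by simp
  have E_nonneg: "E x \<ge> 0" if "s \<le> x" for x
    using est(2)[OF that] E0_nonneg[of x] by simp
  have M0: "M \<ge> 0" using E_nonneg[of s] by (simp add: M_def)
  have EM: "E x \<le> M" if "s \<le> x" for x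
  proof -
    \<comment> \<open>Integrating factor: minus the derivative of
      \<open>4 * K * x powr (- 1/2)\<close> is \<open>2 * K * x powr (- 3/2)\<close>, the rate in
      the bound on \<open>E1\<close>.\<close>
    let ?F = "\<lambda>x. E x * exp (4 * K * x powr (- 1/2))"
    have "?F x \<le> ?F s"
    proof (rule DERIV_nonpos_imp_nonincreasing[OF that])
      fix z assume z: "s \<le> z" "z \<le> x"
      then have z0: "z > 0" using s by simp
      have "DERIV ?F z :> E1 z * exp (4 * K * z powr (- 1/2))
              + exp (4 * K * z powr (- 1/2)) * (4 * K * (- 1/2 * z powr (- 1/2 - 1))) * E z"
        by (intro DERIV_mult deriv z0 DERIV_fun_exp DERIV_cmult has_real_derivative_powr)
      then have "DERIV ?F z :> (E1 z - 2 * K * z powr (- 3/2) * E z) * exp (4 * K * z powr (- 1/2))"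
        by (rule DERIV_cong) (simp add: algebra_simps)
      moreover have "(E1 z - 2 * K * z powr (- 3/2) * E z) * exp (4 * K * z powr (- 1/2)) \<le> 0"
        using est(1)[OF z(1)] by (intro mult_nonpos_nonneg) auto
      ultimately show "\<exists>y. DERIV ?F z :> y \<and> y \<le> 0" by blast
    qed
    moreover have "E x * 1 \<le> ?F x"
      using E_nonneg[OF that] K0 by (intro mult_left_mono) auto
    ultimately show ?thesis by (simp add: M_def)
  qed
  show ?thesis
    unfolding square_integrable_def
  \<comment> \<open>The antiderivative \<open>- 4 * M * x powr (- 1/2)\<close> of the majorant
    \<open>2 * M * x powr (- 3/2)\<close> is bounded above by 0.\<close>
  proof (rule integrable_on_atLeast_if_derivative_bound[where R = s and M = 0])
    show "continuous_on {0..} (\<lambda>x. (norm (w x))\<^sup>2)"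
      by (intro continuous_intros ode_sol_continuous[OF sol])
    show "((\<lambda>x. - 4 * M * x powr (- 1/2)) has_real_derivative - 4 * M * (- 1/2 * x powr (- 1/2 - 1))) (at x)"
      if "s < x" for x
      using that s0 by (intro DERIV_cmult has_real_derivative_powr) auto
    show "continuous_on {s..} (\<lambda>x. - 4 * M * x powr (- 1/2))"
      using s0 by (intro continuous_intros) auto
    show "(norm (w x))\<^sup>2 \<le> - 4 * M * (- 1/2 * x powr (- 1/2 - 1))" if "s < x" for x
    proof -
      have sx: "s \<le> x" using that by simp
      have "(norm (w x))\<^sup>2 \<le> x powr (- 3/2) * E0 x" using est(3)[OF sx] by (simp only: a)
      also have "\<dots> \<le> x powr (- 3/2) * (2 * M)"
        using est(2)[OF sx] EM[OF sx] by (intro mult_left_mono) auto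
      finally show ?thesis by (simp add: mult_ac)
    qed
    show "- 4 * M * x powr (- 1/2) \<le> 0" for x using M0 by simp
  qed (use s0 in auto)
qed

subsection \<open>Reflection of the half-line\<close>

text \<open>Reflection flips the sign of the first derivative and keeps that of the second, so the
  leading coefficient is unchanged.\<close>

lemma is_solution_reflect:
  assumes "is_solution c p lam I w"
  shows "is_solution c (\<lambda>x. p (- x)) lam (uminus ` I) (\<lambda>x. w (- x))"
proof -
  obtain w1 w2 where
    H: "\<forall>a\<in>I. \<forall>b\<in>I. a \<le> b \<longrightarrow>
          w1 absolutely_integrable_on {a..b} \<and> (w1 has_integral (w b - w a)) {a..b} \<and>
          w2 absolutely_integrable_on {a..b} \<and> (w2 has_integral (w1 b - w1 a)) {a..b}"
    and n: "negligible {x \<in> I. - c * w2 x - p x * w x \<noteq> lam * w x}"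
    using assms unfolding is_solution_def by (elim exE conjE)
  have "(\<lambda>x. - w1 (- x)) absolutely_integrable_on {a..b} \<and>
        ((\<lambda>x. - w1 (- x)) has_integral (w (- b) - w (- a))) {a..b} \<and>
        (\<lambda>x. w2 (- x)) absolutely_integrable_on {a..b} \<and>
        ((\<lambda>x. w2 (- x)) has_integral (- w1 (- b) - - w1 (- a))) {a..b}"
    if "a \<in> uminus ` I" "b \<in> uminus ` I" "a \<le> b" for a b
  proof -
    have "- b \<in> I" "- a \<in> I" "- b \<le> - a" using that by auto
    then have h: "w1 absolutely_integrable_on {- b..- a}" "(w1 has_integral (w (- a) - w (- b))) {- b..- a}"
      "w2 absolutely_integrable_on {- b..- a}" "(w2 has_integral (w1 (- a) - w1 (- b))) {- b..- a}"
      using H by blast+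
    have "(\<lambda>x. w1 (- x)) absolutely_integrable_on {a..b}" "(\<lambda>x. w2 (- x)) absolutely_integrable_on {a..b}"
      using h(1,3) absolutely_integrable_reflect_real[where f = w1 and a = "- b" and b = "- a"]
        absolutely_integrable_reflect_real[where f = w2 and a = "- b" and b = "- a"] by simp_all
    moreover from this(1) have "(\<lambda>x. - 1 * w1 (- x)) absolutely_integrable_on {a..b}"
      by (intro set_integrable_mult_right)
    moreover have "((\<lambda>x. - w1 (- x)) has_integral - (w (- a) - w (- b))) {a..b}"
      using has_integral_reflect_lemma_real[OF h(2)] by (intro has_integral_neg) simp
    moreover have "((\<lambda>x. w2 (- x)) has_integral (w1 (- a) - w1 (- b))) {a..b}"
      using has_integral_reflect_lemma_real[OF h(4)] by simp
    ultimately show ?thesis by simp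
  qed
  moreover have "negligible {x \<in> uminus ` I. - c * w2 (- x) - p (- x) * w (- x) \<noteq> lam * w (- x)}"
  proof -
    have "{x \<in> uminus ` I. - c * w2 (- x) - p (- x) * w (- x) \<noteq> lam * w (- x)} =
          uminus ` {x \<in> I. - c * w2 x - p x * w x \<noteq> lam * w x}"
      by auto
    moreover have "negligible \<dots>"
      by (rule negligible_differentiable_image_negligible[OF _ n])
         (auto intro!: derivative_intros)
    ultimately show ?thesis by simp
  qed
  ultimately show ?thesis
    unfolding is_solution_def
    by - (rule exI[of _ "\<lambda>x. - w1 (- x)"], rule exI[of _ "\<lambda>x. w2 (- x)"], rule conjI, blast, assumption)
qed

lemma is_solution_reflect_iff:
  "is_solution c p lam {..0} w \<longleftrightarrow> is_solution c (\<lambda>x. p (- x)) lam {0..} (\<lambda>x. w (- x))"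
  using is_solution_reflect[of c p lam "{..0}" w]
    is_solution_reflect[of c "\<lambda>x. p (- x)" lam "{0..}" "\<lambda>x. w (- x)"] by auto

text \<open>For a nonnegative integrand, integrability is absolute integrability, so the reflection
  rule for absolute integrals applies.\<close>

lemma square_integrable_reflect_iff:
  "square_integrable {..0} w \<longleftrightarrow> square_integrable {0..} (\<lambda>x. w (- x))"
proof -
  let ?f = "\<lambda>x. (norm (w x))\<^sup>2"
  have "?f absolutely_integrable_on {..0} \<longleftrightarrow> (\<lambda>x. ?f (- x)) absolutely_integrable_on {0..}"
    using has_absolute_integral_reflect_real[of "{0..}" "{..0}" ?f] by auto
  then show ?thesis
    unfolding square_integrable_def
    by (metis (mono_tags, lifting) nonnegative_absolutely_integrable_1 set_lebesgue_integral_eq_integral(1)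
        zero_le_power2)
qed

lemma limit_circle_reflect:
  assumes "limit_circle c (\<lambda>x. p (- x)) lam {0..}"
  shows "limit_circle c p lam {..0}"
  using assms unfolding limit_circle_def is_solution_reflect_iff square_integrable_reflect_iff by blast

lemma limit_point_reflect:
  assumes "limit_point c (\<lambda>x. p (- x)) lam {0..}"
  shows "limit_point c p lam {..0}"
proof -
  obtain w0 where w0: "is_solution c (\<lambda>x. p (- x)) lam {0..} w0" "square_integrable {0..} w0"
      "\<exists>x\<in>{0..}. w0 x \<noteq> 0"
    and uniq: "\<And>w. is_solution c (\<lambda>x. p (- x)) lam {0..} w \<Longrightarrow> square_integrable {0..} w \<Longrightarrow>
                (\<exists>a. \<forall>x\<in>{0..}. w x = a * w0 x)"
    using assms unfolding limit_point_def by blast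
  have "\<exists>a. \<forall>x\<in>{..0}. w x = a * w0 (- x)"
    if w: "is_solution c p lam {..0} w" "square_integrable {..0} w" for w
  proof -
    obtain a where a: "\<forall>x\<in>{0..}. w (- x) = a * w0 x"
      using uniq[OF w[unfolded is_solution_reflect_iff square_integrable_reflect_iff]] by blast
    have "w x = a * w0 (- x)" if "x \<in> {..0}" for x
      using bspec[OF a, of "- x"] that by simp
    then show ?thesis by blast
  qed
  moreover have "\<exists>x\<in>{..0}. w0 (- x) \<noteq> 0"
    using w0(3) by (metis add.inverse_inverse atLeast_iff atMost_iff neg_le_0_iff_le)
  ultimately show ?thesis
    unfolding limit_point_def using w0(1,2)
    by (intro exI[of _ "\<lambda>x. w0 (- x)"])
       (auto simp: is_solution_reflect_iff square_integrable_reflect_iff)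
qed

section \<open>Limit-point and limit-circle criteria for power potentials\<close>

text \<open>The choice is \<open>e = cnj (csqrt A)\<close>: off the closed negative axis the
  principal root has positive real part, and \<open>e * A\<close> is a positive multiple of that
  root.\<close>

lemma limit_point_power_potential:
  assumes "c \<noteq> 0" "A \<notin> \<real>\<^sub>\<le>\<^sub>0" "m \<ge> 1"
    and p: "\<And>x. x \<ge> 0 \<Longrightarrow> p x + lam = - c * (A * complex_of_real x ^ m + B)"
  shows "limit_point c p lam {0..}"
proof -
  let ?q = "\<lambda>x. A * complex_of_real x ^ m + B"
  define z where "z = csqrt A"
  define e where "e = cnj z"
  have zz: "z * z = A" by (simp add: z_def power2_eq_square[symmetric])
  have "Re z \<noteq> 0"
  proof
    assume "Re z = 0"
    then have "A = of_real (- (Im z)\<^sup>2)"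
      unfolding zz[symmetric] by (simp add: complex_eq_iff power2_eq_square)
    then have "A \<in> \<real>\<^sub>\<le>\<^sub>0"
      by (metis nonpos_Reals_of_real_iff neg_le_0_iff_le zero_le_power2)
    then show False using assms(2) by simp
  qed
  then have Re_pos: "Re z > 0"
    using Re_csqrt[of A] by (simp only: z_def less_le) simp
  have eA: "e * A = of_real ((norm z)\<^sup>2) * z"
    unfolding complex_norm_square e_def zz[symmetric] by (simp add: mult_ac)
  have eA_pos: "Re (e * A) > 0"
    unfolding eA using Re_pos by (auto simp: zero_less_mult_iff simp del: of_real_power)
  have e_pos: "Re e > 0" using Re_pos by (simp add: e_def)
  define d where "d = min (Re e) (Re (e * A))"
  \<comment> \<open>Beyond \<open>R\<close> the leading term absorbs \<open>B\<close>, because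
    \<open>Re (e * A) * R = Re (e * A) + |Re (e * B)|\<close>; the summand 1 ensures
    \<open>x <= x ^ m\<close>.\<close>
  define R where "R = 1 + \<bar>Re (e * B)\<bar> / Re (e * A)"
  have cq: "continuous_on {0..} ?q" by (intro continuous_intros)
  interpret sectorial_ode ?q e d R
  proof
    show "continuous_on {0..} ?q" by (rule cq)
    show "d > 0" "R \<ge> 0" "Re e \<ge> d" using e_pos eA_pos by (auto simp: d_def R_def)
    fix x assume "x \<ge> R"
    have "R \<ge> 1" using eA_pos by (simp add: R_def)
    then have "x \<ge> 1" using \<open>x \<ge> R\<close> by simp
    have "Re (e * A) + \<bar>Re (e * B)\<bar> = Re (e * A) * R"
      using eA_pos by (simp add: R_def field_simps)
    also have "\<dots> \<le> Re (e * A) * x ^ m"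
      using eA_pos \<open>x \<ge> R\<close> \<open>x \<ge> 1\<close> power_increasing[of 1 m x] \<open>m \<ge> 1\<close> by (intro mult_left_mono) auto
    finally have "Re (e * A) \<le> Re (e * A) * x ^ m + Re (e * B)" by linarith
    moreover have "e * ?q x = (e * A) * of_real (x ^ m) + e * B" by (simp add: algebra_simps)
    then have "Re (e * ?q x) = Re (e * A) * x ^ m + Re (e * B)"
      by (simp only: plus_complex.sel times_complex.sel Re_complex_of_real Im_complex_of_real)
    ultimately show "d \<le> Re (e * ?q x)" by (simp add: d_def)
  qed
  have iff: "is_solution c p lam {0..} w \<longleftrightarrow> (\<exists>w'. ode_sol ?q w w')" for w
    by (rule is_solution_iff_ode_sol[OF assms(1) cq p])
  obtain u u' v v' where "ode_sol ?q u u'" "u 0 = 1" "u' 0 = 0" "ode_sol ?q v v'" "v 0 = 0" "v' 0 = 1"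
    using ode_sol_exists by metis
  then obtain w w' where w: "ode_sol ?q w w'" "square_integrable {0..} w" "\<exists>x\<ge>0. w x \<noteq> 0"
    using exists_square_integrable by blast
  show ?thesis
    unfolding limit_point_def iff
    using w square_integrable_proportional[OF w] by (intro exI[of _ w]) (auto simp: Ball_def)
qed

lemma limit_circle_power_potential:
  assumes "c \<noteq> 0" "m \<ge> 3"
    and p: "\<And>x. x \<ge> 0 \<Longrightarrow> p x + lam = - c * (- (complex_of_real x ^ m) + B)"
  shows "limit_circle c p lam {0..}"
proof -
  have cq: "continuous_on {0..} (\<lambda>x. - (complex_of_real x ^ m) + B)" by (intro continuous_intros)
  have "is_solution c p lam {0..} w \<longleftrightarrow> (\<exists>w'. ode_sol (\<lambda>x. - (complex_of_real x ^ m) + B) w w')" for w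
    by (rule is_solution_iff_ode_sol[OF assms(1) cq p])
  then show ?thesis
    unfolding limit_circle_def using square_integrable_oscillatory[OF _ assms(2)] by blast
qed

subsection \<open>Stokes geometry\<close>

text \<open>Both half-lines at once, with \<open>x >= 0\<close> and \<open>\<sigma>\<close> the
  sign. Up to that sign, the power contributes the angle \<open>(N + 2) * (\<phi> + pi/2)\<close>,
  the minus sign \<open>pi\<close>, and division by the leading coefficient
  \<open>2 * \<phi>\<close>; they add up to \<open>(N + 4) * (\<phi> + pi/2)\<close>.\<close>

lemma half_line_coefficients:
  assumes "\<sigma> = 1 \<or> \<sigma> = - 1"
  shows "potential_hl N \<sigma> \<phi> (\<sigma> * x) + lam =
    - lead_coeff_hl \<sigma> \<phi> *
      (cis (\<sigma> * (real (N + 4) * (\<phi> + pi / 2))) * complex_of_real x ^ (N + 2) + - lam * cis (2 * \<sigma> * \<phi>))"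
proof -
  have c: "lead_coeff_hl \<sigma> \<phi> = cis (- 2 * \<sigma> * \<phi>)"
    unfolding lead_coeff_hl_def cis_conv_exp by (simp add: mult_ac)
  have i: "\<i> * complex_of_real (\<sigma> * x) = cis (\<sigma> * (pi / 2)) * complex_of_real x"
    using assms by auto
  have e: "exp (complex_of_real \<sigma> * (of_nat N + 2) * \<i> * complex_of_real \<phi>) = cis (\<sigma> * (real (N + 2) * \<phi>))"
    unfolding cis_conv_exp by (simp add: mult_ac add_ac)
  have m1: "cis (\<sigma> * pi) = - 1" using assms cis_pi cis_cnj[of pi] by auto
  have "potential_hl N \<sigma> \<phi> (\<sigma> * x) =
      cis (real (N + 2) * (\<sigma> * (pi / 2))) * cis (\<sigma> * (real (N + 2) * \<phi>)) * complex_of_real x ^ (N + 2)"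
    unfolding potential_hl_def i e by (simp only: power_mult_distrib Complex.DeMoivre) (simp only: mult_ac)
  also have "cis (real (N + 2) * (\<sigma> * (pi / 2))) * cis (\<sigma> * (real (N + 2) * \<phi>)) =
      - (cis (\<sigma> * pi) * (cis (real (N + 2) * (\<sigma> * (pi / 2))) * cis (\<sigma> * (real (N + 2) * \<phi>))))"
    by (simp add: m1)
  also have "\<dots> = - (cis (- 2 * \<sigma> * \<phi>) * cis (\<sigma> * (real (N + 4) * (\<phi> + pi / 2))))"
    unfolding cis_mult by (simp add: algebra_simps add_divide_distrib)
  finally have "potential_hl N \<sigma> \<phi> (\<sigma> * x) =
      - (cis (- 2 * \<sigma> * \<phi>) * cis (\<sigma> * (real (N + 4) * (\<phi> + pi / 2)))) * complex_of_real x ^ (N + 2)" .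
  moreover have "cis (- 2 * \<sigma> * \<phi>) * cis (2 * \<sigma> * \<phi>) = 1"
    unfolding cis_mult by simp
  ultimately show ?thesis unfolding c by (simp add: algebra_simps)
qed

text \<open>The map from \<open>t\<close> to \<open>(N + 4) * (t + pi/2)\<close> sends Stokes angles
  to odd multiples of \<open>pi\<close>, where the coefficient \<open>A\<close> is -1, and wedges to
  the intervals between them.\<close>

lemma stokes_theta_scaled:
  "real (N + 4) * (stokes_theta N k + pi / 2) = (2 * of_int k + 1) * pi"
proof -
  define n where "n = real N + 4"
  have n: "n > 0" and N: "real N + 2 = n - 2" "2 * real N + 8 = 2 * n" "real N + 4 = n" "real (N + 4) = n"
    by (simp_all add: n_def)
  show ?thesis
    unfolding stokes_theta_def N using n by (simp add: field_simps)
qed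

text \<open>Angles are known only modulo \<open>2 * pi\<close>; the integer factor \<open>n\<close>
  keeps the scaled angle well defined modulo \<open>2 * pi\<close>.\<close>

lemma cis_scaled_eq:
  assumes "cis s = cis t"
  shows "cis (real n * (s + u)) = cis (real n * (t + u))"
proof -
  have "cis (real n * (y + u)) = (cis y * cis u) ^ n" for y
    by (simp only: cis_mult Complex.DeMoivre)
  then show ?thesis by (simp only: assms)
qed

lemma cis_not_nonpos_Reals:
  assumes "- pi < u" "u < pi"
  shows "cis u \<notin> \<real>\<^sub>\<le>\<^sub>0"
proof
  assume "cis u \<in> \<real>\<^sub>\<le>\<^sub>0"
  then have "sin u = 0" "cos u \<le> 0" by (auto simp: complex_nonpos_Reals_iff)
  then show False using assms sin_eq_0_pi[of u] by auto
qed

text \<open>Representative point of the right ray. By symmetry it governs the left half-line too,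
  where the coefficient \<open>A\<close> is the complex conjugate.\<close>

lemma cis_in_Gamma_contour: "cis \<phi> \<in> Gamma_contour \<phi>"
  unfolding Gamma_contour_def by (intro CollectI exI[of _ 1]) simp

text \<open>After subtracting \<open>2 * pi * k\<close>, the scaled angle lies strictly between
  \<open>- pi\<close> and \<open>pi\<close>, an interval symmetric under the sign
  \<open>\<sigma>\<close>.\<close>

lemma stokes_wedge_imp_not_nonpos:
  assumes "cis \<phi> \<in> stokes_wedge N k" and "\<sigma> = 1 \<or> \<sigma> = - 1"
  shows "cis (\<sigma> * (real (N + 4) * (\<phi> + pi / 2))) \<notin> \<real>\<^sub>\<le>\<^sub>0"
proof -
  obtain t where t: "cis \<phi> = cis t" "stokes_theta N (k - 1) < t" "t < stokes_theta N k"
    using assms(1) unfolding stokes_wedge_def by auto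
  define \<omega> where "\<omega> = real (N + 4) * (t + pi / 2)"
  have "\<omega> < real (N + 4) * (stokes_theta N k + pi / 2)"
    unfolding \<omega>_def using t(3) by (intro mult_strict_left_mono) auto
  then have 1: "\<omega> - 2 * pi * of_int k < pi"
    unfolding stokes_theta_scaled by (simp add: algebra_simps)
  have "real (N + 4) * (stokes_theta N (k - 1) + pi / 2) < \<omega>"
    unfolding \<omega>_def using t(2) by (intro mult_strict_left_mono) auto
  then have 2: "- pi < \<omega> - 2 * pi * of_int k"
    unfolding stokes_theta_scaled by (simp add: algebra_simps)
  have "cis (real (N + 4) * (\<phi> + pi / 2)) = cis \<omega>"
    unfolding \<omega>_def by (rule cis_scaled_eq[OF t(1)])
  also have "\<dots> = cis (\<omega> - 2 * pi * of_int k)"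
    unfolding cis_divide[symmetric] by simp
  finally have eq: "cis (real (N + 4) * (\<phi> + pi / 2)) = cis (\<omega> - 2 * pi * of_int k)" .
  have "cis (\<sigma> * (real (N + 4) * (\<phi> + pi / 2))) = cis (\<sigma> * (\<omega> - 2 * pi * of_int k))"
    using assms(2)
  proof
    assume "\<sigma> = - 1"
    then show ?thesis using arg_cong[OF eq, of cnj] by (simp only: cis_cnj mult_minus1)
  qed (use eq in simp)
  moreover have "- pi < \<sigma> * (\<omega> - 2 * pi * of_int k)" "\<sigma> * (\<omega> - 2 * pi * of_int k) < pi"
    using assms(2) 1 2 by auto
  ultimately show ?thesis using cis_not_nonpos_Reals by simp
qed

lemma stokes_line_imp_minus_one:
  assumes "cis \<phi> \<in> stokes_line N k" and "\<sigma> = 1 \<or> \<sigma> = - 1"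
  shows "cis (\<sigma> * (real (N + 4) * (\<phi> + pi / 2))) = - 1"
proof -
  obtain r where r: "cis \<phi> = complex_of_real r * cis (stokes_theta N k)" "r \<ge> 0"
    using assms(1) unfolding stokes_line_def by auto
  have "r = 1" using arg_cong[OF r(1), of norm] r(2) by (simp add: norm_mult)
  then have "cis \<phi> = cis (stokes_theta N k)" using r by simp
  then have "cis (real (N + 4) * (\<phi> + pi / 2)) = cis (real (N + 4) * (stokes_theta N k + pi / 2))"
    by (rule cis_scaled_eq)
  also have "\<dots> = cis (2 * pi * of_int k) * cis pi"
    unfolding stokes_theta_scaled cis_mult by (simp add: algebra_simps)
  finally have eq: "cis (real (N + 4) * (\<phi> + pi / 2)) = - 1" by simp
  show ?thesis
    using assms(2)
  proof
    assume "\<sigma> = - 1"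
    then show ?thesis using arg_cong[OF eq, of cnj] by (simp only: cis_cnj mult_minus1) simp
  qed (use eq in simp)
qed

lemma lead_coeff_hl_nonzero: "lead_coeff_hl s \<phi> \<noteq> 0"
  by (simp add: lead_coeff_hl_def)

theorem theorem2:
  fixes N :: nat and \<phi> :: real
  assumes "N \<ge> 1" and "- (pi / 2) < \<phi>" and "\<phi> < pi / 2"
  shows "(Gamma_contour \<phi> - {0} \<subseteq> (\<Union>k\<in>{0..int N + 3}. stokes_wedge N k) \<longrightarrow>
            (\<forall>lam. limit_point (lead_coeff_hl 1 \<phi>) (potential_hl N 1 \<phi>) lam {0..} \<and>
                   limit_point (lead_coeff_hl (-1) \<phi>) (potential_hl N (-1) \<phi>) lam {..0}))
       \<and> (Gamma_contour \<phi> \<subseteq> (\<Union>k\<in>{0..int N + 3}. stokes_line N k) \<longrightarrow>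
            (\<forall>lam. limit_circle (lead_coeff_hl 1 \<phi>) (potential_hl N 1 \<phi>) lam {0..} \<and>
                   limit_circle (lead_coeff_hl (-1) \<phi>) (potential_hl N (-1) \<phi>) lam {..0}))"
proof (intro conjI impI)
  assume "Gamma_contour \<phi> - {0} \<subseteq> (\<Union>k\<in>{0..int N + 3}. stokes_wedge N k)"
  then obtain k where k: "cis \<phi> \<in> stokes_wedge N k"
    using cis_in_Gamma_contour[of \<phi>] by fastforce
  \<comment> \<open>For \<open>\<sigma> = - 1\<close> this is the reflected problem, carried back to
    the negative half-line by \<open>limit_point_reflect\<close>.\<close>
  have *: "limit_point (lead_coeff_hl \<sigma> \<phi>) (\<lambda>x. potential_hl N \<sigma> \<phi> (\<sigma> * x)) lam {0..}"
    if "\<sigma> = 1 \<or> \<sigma> = - 1" for \<sigma> lam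
    using that
    by (intro limit_point_power_potential[OF lead_coeff_hl_nonzero stokes_wedge_imp_not_nonpos[OF k]
          _ half_line_coefficients]) auto
  show "\<forall>lam. limit_point (lead_coeff_hl 1 \<phi>) (potential_hl N 1 \<phi>) lam {0..} \<and>
              limit_point (lead_coeff_hl (-1) \<phi>) (potential_hl N (-1) \<phi>) lam {..0}"
    using *[of 1] *[of "- 1"] by (auto intro: limit_point_reflect)
next
  assume "Gamma_contour \<phi> \<subseteq> (\<Union>k\<in>{0..int N + 3}. stokes_line N k)"
  then obtain k where k: "cis \<phi> \<in> stokes_line N k"
    using cis_in_Gamma_contour[of \<phi>] by fastforce
  \<comment> \<open>Here \<open>N >= 1\<close> supplies the exponent \<open>N + 2 >= 3\<close> that
    the decay estimate requires.\<close>
  have *: "limit_circle (lead_coeff_hl \<sigma> \<phi>) (\<lambda>x. potential_hl N \<sigma> \<phi> (\<sigma> * x)) lam {0..}"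
    if \<sigma>: "\<sigma> = 1 \<or> \<sigma> = - 1" for \<sigma> lam
    using half_line_coefficients[OF \<sigma>, of N \<phi> _ lam] assms(1)
    unfolding stokes_line_imp_minus_one[OF k \<sigma>] mult_minus1
    by (intro limit_circle_power_potential[OF lead_coeff_hl_nonzero, of "N + 2"]) auto
  show "\<forall>lam. limit_circle (lead_coeff_hl 1 \<phi>) (potential_hl N 1 \<phi>) lam {0..} \<and>
              limit_circle (lead_coeff_hl (-1) \<phi>) (potential_hl N (-1) \<phi>) lam {..0}"
    using *[of 1] *[of "- 1"] by (auto intro: limit_circle_reflect)
qed

end
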